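(* Let $G_w$ be a weighted bicyclic graph. Then $i_+(G_w)=1$ if and only if $G_w$ is (isomorphic as a weighted graph to) one of the following: $\theta(1,1,1)_w$ with weights satisfying $c_1a_2=a_1c_2$ and $a_2b_1=a_1b_2$; or $\theta(1,0,1)_w$ with weights satisfying $a_2c_1=a_1c_2$.
   Context: A weighted graph is a simple graph with a positive weight on each edge; its adjacency matrix has entry $w(xy)$ if $xy$ is an edge and $0$ otherwise, and $i_+(G_w)$ (resp. $i_-(G_w)$) is the number of positive (resp. negative) eigenvalues of this matrix, with multiplicity. A bicyclic graph is a connected simple graph with $|E|=|V|+1$. For integers $p,l,q\ge0$ with at most one equal to $0$, $\theta(p,l,q)_w$ is the weighted graph consisting of two vertices $u,v$ joined by three internally disjoint paths $u x_1\cdots x_p v$, $u y_1\cdots y_l v$, $u z_1\cdots z_q v$ (a path with no internal vertices being the edge $uv$), where the edge weights along the first path, read from $u$ to $v$, are $a_1,\dots,a_{p+1}$, along the second path $b_1,\dots,b_{l+1}$, and along the third path $c_1,\dots,c_{q+1}$ (all positive). Thus in $\theta(1,1,1)_w$: $w(ux_1)=a_1$, $w(x_1v)=a_2$, $w(uy_1)=b_1$, $w(y_1v)=b_2$, $w(uz_1)=c_1$, $w(z_1v)=c_2$; in $\theta(1,0,1)_w$: $w(ux_1)=a_1$, $w(x_1v)=a_2$, $w(uv)=b_1$, $w(uz_1)=c_1$, $w(z_1v)=c_2$. *)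

theory Defs
  imports "Jordan_Normal_Form.Char_Poly"
begin

section \<open>Weighted graphs\<close>

text \<open>Edges are two-element sets of vertices, so loops and parallel edges are excluded. The value
  of \<open>wt\<close> outside the edge set is irrelevant.\<close>

record 'a wgraph =
  verts :: "'a set"
  edges :: "'a set set"
  wt :: "'a set \<Rightarrow> real"

definition weighted_graph :: "'a wgraph \<Rightarrow> bool" where
  "weighted_graph G \<longleftrightarrow>
     finite (verts G) \<and>
     (\<forall>e\<in>edges G. e \<subseteq> verts G \<and> card e = 2) \<and>
     (\<forall>e\<in>edges G. wt G e > 0)"

definition adj_rel :: "'a wgraph \<Rightarrow> ('a \<times> 'a) set" where
  "adj_rel G = {(x, y). {x, y} \<in> edges G}"

definition connected_graph :: "'a wgraph \<Rightarrow> bool" where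
  "connected_graph G \<longleftrightarrow>
     verts G \<noteq> {} \<and> (\<forall>x\<in>verts G. \<forall>y\<in>verts G. (x, y) \<in> (adj_rel G)\<^sup>*)"

definition bicyclic :: "'a wgraph \<Rightarrow> bool" where
  "bicyclic G \<longleftrightarrow> connected_graph G \<and> card (edges G) = card (verts G) + 1"

definition wgraph_iso :: "'a wgraph \<Rightarrow> 'b wgraph \<Rightarrow> bool" where
  "wgraph_iso G H \<longleftrightarrow>
     (\<exists>f. bij_betw f (verts G) (verts H) \<and>
          (\<forall>x\<in>verts G. \<forall>y\<in>verts G. {x, y} \<in> edges G \<longleftrightarrow> {f x, f y} \<in> edges H) \<and>
          (\<forall>x\<in>verts G. \<forall>y\<in>verts G. {x, y} \<in> edges G \<longrightarrow> wt G {x, y} = wt H {f x, f y}))"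

section \<open>Adjacency matrix and positive index of inertia\<close>

definition adj_matrix :: "'a wgraph \<Rightarrow> 'a list \<Rightarrow> real mat" where
  "adj_matrix G xs =
     mat (length xs) (length xs)
       (\<lambda>(i, j). if {xs ! i, xs ! j} \<in> edges G then wt G {xs ! i, xs ! j} else 0)"

definition num_pos_eigenvalues :: "real mat \<Rightarrow> nat" where
  "num_pos_eigenvalues A = (\<Sum>r | eigenvalue A r \<and> r > 0. order r (char_poly A))"

text \<open>The ordering of the vertices chosen here is immaterial, see \<open>i_plus_eq\<close> below.\<close>

definition i_plus :: "'a wgraph \<Rightarrow> nat" where
  "i_plus G = num_pos_eigenvalues (adj_matrix G (SOME xs. distinct xs \<and> set xs = verts G))"

lemma det_permute_rows_columns:
  fixes f :: "nat \<times> nat \<Rightarrow> 'b :: comm_ring_1"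
  assumes p: "p permutes {0..<n}"
  shows "det (mat n n (\<lambda>(i, j). f (p i, p j))) = det (mat n n f)"
proof -
  have pn: "p i < n" if "i < n" for i
    using permutes_in_image[OF p, of i] that by simp
  define B where "B = mat n n (\<lambda>(i, j). f (i, p j))"
  have B: "B \<in> carrier_mat n n" by (simp add: B_def)
  have "mat n n (\<lambda>(i, j). f (p i, p j)) = mat n n (\<lambda>(i, j). B $$ (p i, j))"
    by (rule eq_matI) (auto simp: B_def pn)
  then have 1: "det (mat n n (\<lambda>(i, j). f (p i, p j))) = signof p * det B"
    using det_permute_rows[OF B p] by simp
  define C where "C = mat n n (\<lambda>(i, j). f (j, i))"
  have C: "C \<in> carrier_mat n n" by (simp add: C_def)
  have "transpose_mat B = mat n n (\<lambda>(i, j). C $$ (p i, j))"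
    by (rule eq_matI) (auto simp: B_def C_def pn)
  then have 2: "det B = signof p * det C"
    using det_permute_rows[OF C p] det_transpose[OF B] by simp
  have "transpose_mat C = mat n n f"
    by (rule eq_matI) (auto simp: C_def)
  then have 3: "det C = det (mat n n f)"
    using det_transpose[OF C] by simp
  show ?thesis
    unfolding 1 2 3 by (simp add: sign_def)
qed

lemma char_poly_adj_matrix_cong:
  assumes "distinct xs" "distinct ys" "set xs = set ys"
  shows "char_poly (adj_matrix G xs) = char_poly (adj_matrix G ys)"
proof -
  have "mset xs = mset ys"
    using assms by (simp add: set_eq_iff_mset_eq_distinct)
  then obtain p where p: "p permutes {..<length ys}" and xs: "permute_list p ys = xs"
    by (rule mset_eq_permutation)
  have len: "length xs = length ys"
    using xs by auto
  have nth: "xs ! i = ys ! p i" if "i < length ys" for i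
    using permute_list_nth[OF p that] xs by simp
  have pn: "p i < length ys" if "i < length ys" for i
    using permutes_in_image[OF p, of i] that by simp
  have inj: "p i = p j \<longleftrightarrow> i = j" for i j
    using permutes_inj[OF p] by (auto dest: injD)
  let ?n = "length ys"
  define f where "f = (\<lambda>ij. char_poly_matrix (adj_matrix G ys) $$ ij)"
  have "char_poly_matrix (adj_matrix G ys) = mat ?n ?n f"
    by (rule eq_matI) (auto simp: f_def char_poly_matrix_def adj_matrix_def)
  moreover have "char_poly_matrix (adj_matrix G xs) = mat ?n ?n (\<lambda>(i, j). f (p i, p j))"
    by (rule eq_matI)
      (auto simp: f_def char_poly_matrix_def adj_matrix_def len nth pn inj)
  ultimately show ?thesis
    using det_permute_rows_columns[of p ?n f] p
    by (simp add: char_poly_def atLeast0LessThan)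
qed

lemma i_plus_eq:
  assumes "distinct xs" "set xs = verts G"
  shows "i_plus G = num_pos_eigenvalues (adj_matrix G xs)"
proof -
  define ys where "ys = (SOME ys. distinct ys \<and> set ys = verts G)"
  have ys: "distinct ys \<and> set ys = verts G"
    unfolding ys_def by (rule someI[of _ xs]) (use assms in simp)
  have cp: "char_poly (adj_matrix G ys) = char_poly (adj_matrix G xs)"
    by (rule char_poly_adj_matrix_cong) (use ys assms in auto)
  have ev: "eigenvalue (adj_matrix G zs) r \<longleftrightarrow> poly (char_poly (adj_matrix G zs)) r = 0" for zs r
    by (rule eigenvalue_root_char_poly[of _ "length zs"]) (simp add: adj_matrix_def)
  show ?thesis
    unfolding i_plus_def ys_def[symmetric] num_pos_eigenvalues_def ev cp ..
qed

section \<open>Theta graphs\<close>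

datatype theta_vertex = Tu | Tv | Tx nat | Ty nat | Tz nat

text \<open>The path from \<open>Tu\<close> to \<open>Tv\<close> with internal vertices \<open>X 1, \<dots>, X n\<close>: its vertices are
  numbered \<open>0, \<dots>, n + 1\<close> and its edges \<open>1, \<dots>, n + 1\<close>, as read from \<open>Tu\<close> to \<open>Tv\<close>.\<close>

definition path_vertex :: "(nat \<Rightarrow> theta_vertex) \<Rightarrow> nat \<Rightarrow> nat \<Rightarrow> theta_vertex" where
  "path_vertex X n i = (if i = 0 then Tu else if i \<le> n then X i else Tv)"

definition path_edge :: "(nat \<Rightarrow> theta_vertex) \<Rightarrow> nat \<Rightarrow> nat \<Rightarrow> theta_vertex set" where
  "path_edge X n i = {path_vertex X n (i - 1), path_vertex X n i}"

definition theta ::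
    "nat \<Rightarrow> nat \<Rightarrow> nat \<Rightarrow> (nat \<Rightarrow> real) \<Rightarrow> (nat \<Rightarrow> real) \<Rightarrow> (nat \<Rightarrow> real) \<Rightarrow> theta_vertex wgraph" where
  "theta p l q a b c =
     \<lparr> verts = {Tu, Tv} \<union> Tx ` {1..p} \<union> Ty ` {1..l} \<union> Tz ` {1..q},
       edges = path_edge Tx p ` {1..p+1} \<union> path_edge Ty l ` {1..l+1} \<union> path_edge Tz q ` {1..q+1},
       wt = (\<lambda>e. THE r.
          (\<exists>i\<in>{1..p+1}. e = path_edge Tx p i \<and> r = a i) \<or>
          (\<exists>i\<in>{1..l+1}. e = path_edge Ty l i \<and> r = b i) \<or>
          (\<exists>i\<in>{1..q+1}. e = path_edge Tz q i \<and> r = c i)) \<rparr>"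

text \<open>At most one of the three paths is a single edge, which is what makes the weight of an edge
  in \<^const>\<open>theta\<close> well defined (lemma \<open>theta_wt\<close>). Only the weights with the
  indices listed here matter.\<close>

definition theta_params ::
    "nat \<Rightarrow> nat \<Rightarrow> nat \<Rightarrow> (nat \<Rightarrow> real) \<Rightarrow> (nat \<Rightarrow> real) \<Rightarrow> (nat \<Rightarrow> real) \<Rightarrow> bool" where
  "theta_params p l q a b c \<longleftrightarrow>
     \<not> (p = 0 \<and> l = 0) \<and> \<not> (p = 0 \<and> q = 0) \<and> \<not> (l = 0 \<and> q = 0) \<and>
     (\<forall>i\<in>{1..p+1}. a i > 0) \<and> (\<forall>i\<in>{1..l+1}. b i > 0) \<and> (\<forall>i\<in>{1..q+1}. c i > 0)"

lemma path_edge_inj: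
  assumes X: "X = Tx \<or> X = Ty \<or> X = Tz"
    and e: "path_edge X n i = path_edge X n j" and "i \<in> {1..n+1}" "j \<in> {1..n+1}"
  shows "i = j"
  using assms by (auto simp: path_edge_def path_vertex_def doubleton_eq_iff split: if_splits)

lemma path_edge_disjoint:
  assumes "(X, Y) \<in> {(Tx, Ty), (Tx, Tz), (Ty, Tz)}" "\<not> (m = 0 \<and> n = 0)"
    and "i \<in> {1..m+1}" "j \<in> {1..n+1}"
  shows "path_edge X m i \<noteq> path_edge Y n j"
  using assms by (auto simp: path_edge_def path_vertex_def doubleton_eq_iff split: if_splits)

lemma theta_wt:
  assumes "theta_params p l q a b c"
  shows "i \<in> {1..p+1} \<Longrightarrow> wt (theta p l q a b c) (path_edge Tx p i) = a i"
    and "i \<in> {1..l+1} \<Longrightarrow> wt (theta p l q a b c) (path_edge Ty l i) = b i"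
    and "i \<in> {1..q+1} \<Longrightarrow> wt (theta p l q a b c) (path_edge Tz q i) = c i"
proof -
  have z: "\<not> (p = 0 \<and> l = 0)" "\<not> (p = 0 \<and> q = 0)" "\<not> (l = 0 \<and> q = 0)"
    using assms by (auto simp: theta_params_def)
  have d: "path_edge Tx p i \<noteq> path_edge Ty l j" if "i \<in> {1..p+1}" "j \<in> {1..l+1}" for i j
    using path_edge_disjoint[of Tx Ty p l i j] that z by simp
  have d': "path_edge Tx p i \<noteq> path_edge Tz q j" if "i \<in> {1..p+1}" "j \<in> {1..q+1}" for i j
    using path_edge_disjoint[of Tx Tz p q i j] that z by simp
  have d'': "path_edge Ty l i \<noteq> path_edge Tz q j" if "i \<in> {1..l+1}" "j \<in> {1..q+1}" for i j
    using path_edge_disjoint[of Ty Tz l q i j] that z by simp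
  note s = path_edge_inj[of Tx p] path_edge_inj[of Ty l] path_edge_inj[of Tz q]
  show "wt (theta p l q a b c) (path_edge Tx p i) = a i" if "i \<in> {1..p+1}"
    unfolding theta_def wgraph.simps
  proof (rule the_equality, goal_cases)
    case 1
    show ?case using that by blast
  next
    case (2 r)
    then show ?case using that by (elim disjE bexE conjE) (metis d d' d'' s)+
  qed
  show "wt (theta p l q a b c) (path_edge Ty l i) = b i" if "i \<in> {1..l+1}"
    unfolding theta_def wgraph.simps
  proof (rule the_equality, goal_cases)
    case 1
    show ?case using that by blast
  next
    case (2 r)
    then show ?case using that by (elim disjE bexE conjE) (metis d d' d'' s)+
  qed
  show "wt (theta p l q a b c) (path_edge Tz q i) = c i" if "i \<in> {1..q+1}"
    unfolding theta_def wgraph.simps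
  proof (rule the_equality, goal_cases)
    case 1
    show ?case using that by blast
  next
    case (2 r)
    then show ?case using that by (elim disjE bexE conjE) (metis d d' d'' s)+
  qed
qed

end

theory Submission
  imports Defs "Jordan_Normal_Form.Spectral_Radius"
begin

text \<open>By the spectral theorem, \<open>i\<^sub>+(G) \<le> 1\<close> holds iff every plane contains a nonzero vector on which
  the quadratic form of \<open>G\<close> is nonpositive. If \<open>x, z\<close> are nonadjacent and \<open>u, v\<close> are two other vertices,
  a nonzero minor \<open>w(ux) w(vz) - w(vx) w(uz)\<close> yields a positive definite plane, so
  \<open>i\<^sub>+(G) = 1\<close> forces all these minors to vanish. In a connected graph this makes
  non-adjacency an equivalence relation: \<open>G\<close> is complete multipartite, and among the bicyclic graphs only
  \<open>K\<^sub>2\<^sub>,\<^sub>3\<close> and \<open>K\<^sub>1\<^sub>,\<^sub>1\<^sub>,\<^sub>2\<close> remain; the vanishing minors are then the conditions on the weights.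
  Conversely, under these conditions the quadratic form is twice a product of two linear forms, minus a
  nonnegative multiple of a square, so it is nonpositive where the sum of the two linear forms vanishes.\<close>

section \<open>Real symmetric matrices\<close>

lemma scalar_prod_self_pos:
  fixes v :: "real vec"
  assumes "v \<in> carrier_vec n" "v \<noteq> 0\<^sub>v n"
  shows "v \<bullet> v > 0"
  using conjugate_square_greater_0_vec[OF assms(1)] assms(2) by simp

text \<open>Complete \<open>v\<close> to a basis, orthogonalize by Gram-Schmidt and normalize.
  Normalization is why the first column is only a multiple of \<open>v\<close>.\<close>

lemma exists_orthogonal_mat_with_col:
  fixes v :: "real vec"
  assumes v: "v \<in> carrier_vec n" "v \<noteq> 0\<^sub>v n"
  shows "\<exists>U\<in>carrier_mat n n. transpose_mat U * U = 1\<^sub>m n \<and> (\<exists>c. c \<noteq> 0 \<and> col U 0 = c \<cdot>\<^sub>v v)"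
proof -
  interpret cof_vec_space n "TYPE(real)" .
  define b where "b = basis_completion v"
  define ws where "ws = gram_schmidt n b"
  note bc = basis_completion[OF v, folded b_def]
  note gs = gram_schmidt_result[OF bc(2) bc(4) bc(5) ws_def]
  have n: "n > 0"
    using v by (cases n) auto
  have len: "length ws = n"
    using gs(4) bc(6) by simp
  obtain bs where bs: "b = v # bs"
    using bc(6,7) n by (cases b) auto
  \<comment> \<open>Gram-Schmidt leaves the first vector of its input unchanged.\<close>
  have ws0: "ws ! 0 = v"
    using gram_schmidt_hd[OF v(1), of bs] len n hd_conv_nth[of ws] unfolding ws_def bs by (metis list.size(3) less_numeral_extra(3))
  have wsc: "ws ! i \<in> carrier_vec n" if "i < n" for i
    using gs(3) len that by auto
  have orth: "ws ! i \<bullet> ws ! j = 0 \<longleftrightarrow> i \<noteq> j" if "i < n" "j < n" for i j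
    using corthogonalD[OF gs(2), of i j] that len by simp
  have pos: "ws ! i \<bullet> ws ! i > 0" if "i < n" for i
    using orth[OF that that] scalar_prod_self_pos[OF wsc[OF that]] wsc[OF that] by fastforce
  define s where "s = (\<lambda>w :: real vec. 1 / sqrt (w \<bullet> w))"
  define U where "U = mat_of_cols n (map (\<lambda>w. s w \<cdot>\<^sub>v w) ws)"
  have U: "U \<in> carrier_mat n n"
    using len by (auto simp: U_def)
  have colU: "col U i = s (ws ! i) \<cdot>\<^sub>v ws ! i" if "i < n" for i
    unfolding U_def using that len wsc[OF that] by (subst col_mat_of_cols) auto
  have "transpose_mat U * U = 1\<^sub>m n"
  proof (rule eq_matI)
    fix i j assume "i < dim_row (1\<^sub>m n :: real mat)" "j < dim_col (1\<^sub>m n :: real mat)"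
    then have i: "i < n" and j: "j < n" by auto
    have "(transpose_mat U * U) $$ (i, j) = col U i \<bullet> col U j"
      using U i j by simp
    also have "\<dots> = s (ws ! i) * (s (ws ! j) * (ws ! i \<bullet> ws ! j))"
      using wsc[OF i] wsc[OF j] by (simp add: colU i j)
    also have "\<dots> = (if i = j then 1 else 0)"
    proof (cases "i = j")
      case True
      have "sqrt (ws ! j \<bullet> ws ! j) * sqrt (ws ! j \<bullet> ws ! j) = ws ! j \<bullet> ws ! j"
        using pos[OF j] by simp
      then show ?thesis
        using True pos[OF j] by (simp add: s_def field_simps)
    qed (use orth[OF i j] in auto)
    finally show "(transpose_mat U * U) $$ (i, j) = 1\<^sub>m n $$ (i, j)"
      using i j by simp
  qed (use U in auto)
  moreover have "s v \<noteq> 0" "col U 0 = s v \<cdot>\<^sub>v v"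
    using colU[OF n] pos[OF n] ws0 by (auto simp: s_def)
  ultimately show ?thesis
    using U by blast
qed

text \<open>Over the complex numbers an eigenvalue exists. Symmetry makes it equal to its conjugate,
  and a real root of the complexified characteristic polynomial is a root of the real one.\<close>

lemma symmetric_real_mat_eigenvalue:
  fixes A :: "real mat"
  assumes A: "A \<in> carrier_mat n n" and sym: "transpose_mat A = A" and n: "n > 0"
  shows "\<exists>e. eigenvalue A e"
proof -
  let ?C = "map_mat complex_of_real A"
  have C: "?C \<in> carrier_mat n n" using A by simp
  obtain z where z: "eigenvalue ?C z"
    using spectrum_non_empty[OF C n] by (auto simp: spectrum_def)
  then obtain v where v: "v \<in> carrier_vec n" "v \<noteq> 0\<^sub>v n" and ev: "?C *\<^sub>v v = z \<cdot>\<^sub>v v"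
    using C by (auto simp: eigenvalue_def eigenvector_def)
  have cv: "conjugate v \<in> carrier_vec n"
    using v by simp
  have symC: "transpose_mat ?C = ?C"
    using sym by (metis map_mat_transpose)
  have conjC: "conjugate (?C *\<^sub>v v) = ?C *\<^sub>v conjugate v"
    using A v by (intro eq_vecI) (auto simp: scalar_prod_def)
  \<comment> \<open>The matrix passes to the other factor by symmetry and commutes with conjugation
    because its entries are real; then the nonzero \<open>v \<bullet>c v\<close> is
    cancelled.\<close>
  have "z * (v \<bullet>c v) = (?C *\<^sub>v v) \<bullet>c v"
    using v ev by simp
  also have "\<dots> = v \<bullet> (?C *\<^sub>v conjugate v)"
    using transpose_vec_mult_scalar[OF C cv v(1)] symC by simp
  also have "\<dots> = cnj z * (v \<bullet>c v)"
    using v by (simp add: conjC[symmetric] ev conjugate_smult_vec)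
  finally have "z = cnj z"
    using v by simp
  then obtain r where r: "z = complex_of_real r"
    by (auto simp: complex_eq_iff intro: that[of "Re z"])
  have "poly (char_poly ?C) z = 0"
    using z eigenvalue_root_char_poly[OF C] by simp
  then have "poly (char_poly A) r = 0"
    by (simp add: of_real_hom.char_poly_hom[OF A] r)
  then show ?thesis
    using eigenvalue_root_char_poly[OF A] by blast
qed

text \<open>Deflation, by induction on \<open>n\<close>: in an orthonormal basis beginning with an
  eigenvector, the matrix splits into a 1 by 1 block and a smaller symmetric block.\<close>

lemma symmetric_real_mat_diagonalization:
  fixes A :: "real mat"
  assumes "A \<in> carrier_mat n n" and "transpose_mat A = A"
  shows "\<exists>P\<in>carrier_mat n n. \<exists>d. transpose_mat P * P = 1\<^sub>m n \<and> transpose_mat P * A * P = mat_diag n d"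
  using assms
proof (induction n arbitrary: A)
  case 0
  then show ?case
    by (intro bexI[of _ "1\<^sub>m 0"] exI[of _ "\<lambda>_. 0"] conjI eq_matI) (auto simp: mat_diag_def)
next
  case (Suc n)
  note A = Suc.prems(1) and sym = Suc.prems(2)
  obtain e where "eigenvalue A e"
    using symmetric_real_mat_eigenvalue[OF A sym] by auto
  then obtain v where v: "v \<in> carrier_vec (Suc n)" "v \<noteq> 0\<^sub>v (Suc n)" and ev: "A *\<^sub>v v = e \<cdot>\<^sub>v v"
    using A by (auto simp: eigenvalue_def eigenvector_def)
  obtain U c where U: "U \<in> carrier_mat (Suc n) (Suc n)" and UU: "transpose_mat U * U = 1\<^sub>m (Suc n)"
    and colU: "col U 0 = c \<cdot>\<^sub>v v"
    using exists_orthogonal_mat_with_col[OF v] by auto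
  define B where "B = transpose_mat U * A * U"
  have B: "B \<in> carrier_mat (Suc n) (Suc n)"
    using U A by (simp add: B_def)
  have AU: "A * U \<in> carrier_mat (Suc n) (Suc n)"
    using A U by simp
  have symB: "transpose_mat B = B"
  proof -
    have "transpose_mat B = transpose_mat U * transpose_mat (transpose_mat U * A)"
      unfolding B_def using A U by (intro transpose_mult) auto
    also have "transpose_mat (transpose_mat U * A) = A * U"
      using A U sym by (subst transpose_mult) auto
    finally show ?thesis
      using A U by (simp add: B_def assoc_mult_mat[of _ "Suc n" "Suc n"])
  qed
  have Bsym: "B $$ (i, j) = B $$ (j, i)" if "i < Suc n" "j < Suc n" for i j
    using arg_cong[OF symB, of "\<lambda>M. M $$ (j, i)"] that B by simp
  \<comment> \<open>\<open>A\<close> multiplies the first column of \<open>U\<close> by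
    \<open>e\<close>, and that column is orthogonal to all the others. The first row follows by
    symmetry.\<close>
  have Bi0: "B $$ (i, 0) = (if i = 0 then e else 0)" if i: "i < Suc n" for i
  proof -
    have "B $$ (i, 0) = (transpose_mat U * (A * U)) $$ (i, 0)"
      using A U by (simp add: B_def assoc_mult_mat[of _ "Suc n" "Suc n"])
    also have "\<dots> = row (transpose_mat U) i \<bullet> col (A * U) 0"
      using U AU i by (intro index_mult_mat) auto
    also have "\<dots> = col U i \<bullet> (A *\<^sub>v col U 0)"
      unfolding col_mult2[OF A U zero_less_Suc] using U i by simp
    also have "A *\<^sub>v col U 0 = e \<cdot>\<^sub>v col U 0"
      using A v ev by (simp add: colU mult_mat_vec smult_smult_assoc mult.commute)
    also have "col U i \<bullet> (e \<cdot>\<^sub>v col U 0) = e * (transpose_mat U * U) $$ (i, 0)"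
      using U i by simp
    finally show ?thesis
      using i by (simp add: UU)
  qed
  have B0i: "B $$ (0, i) = (if i = 0 then e else 0)" if "i < Suc n" for i
    using Bsym[of 0 i] Bi0[OF that] that by simp
  define C where "C = mat n n (\<lambda>(i, j). B $$ (Suc i, Suc j))"
  have C: "C \<in> carrier_mat n n" by (simp add: C_def)
  have B_block: "B = four_block_mat (mat 1 1 (\<lambda>_. e)) (0\<^sub>m 1 n) (0\<^sub>m n 1) C"
    using B by (intro eq_matI) (auto simp: C_def Bi0 B0i)
  have "transpose_mat C = C"
    by (intro eq_matI) (auto simp: C_def Bsym)
  from Suc.IH[OF C this] obtain Q d where Q: "Q \<in> carrier_mat n n"
    and QQ: "transpose_mat Q * Q = 1\<^sub>m n" and QCQ: "transpose_mat Q * C * Q = mat_diag n d"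
    by blast
  define V where "V = four_block_mat (1\<^sub>m 1) (0\<^sub>m 1 n) (0\<^sub>m n 1) Q"
  have V: "V \<in> carrier_mat (Suc n) (Suc n)"
    using Q by (auto simp: V_def)
  have tV: "transpose_mat V = four_block_mat (1\<^sub>m 1) (0\<^sub>m 1 n) (0\<^sub>m n 1) (transpose_mat Q)"
    using Q by (simp add: V_def transpose_four_block_mat[of _ 1 1 _ n _ n])
  have VV: "transpose_mat V * V = 1\<^sub>m (Suc n)"
  proof -
    have "transpose_mat V * V = four_block_mat (1\<^sub>m 1) (0\<^sub>m 1 n) (0\<^sub>m n 1) (1\<^sub>m n)"
      unfolding tV unfolding V_def
      using Q QQ by (subst mult_four_block_mat[of _ 1 1 _ n _ n _ _ 1 _ n]) auto
    also have "\<dots> = 1\<^sub>m (Suc n)"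
      by (intro eq_matI) auto
    finally show ?thesis .
  qed
  \<comment> \<open>The split-off eigenvalue \<open>e\<close> takes index 0, and the eigenvalues of
    the smaller block move up by one; hence \<open>case_nat e d\<close>.\<close>
  have VBV: "transpose_mat V * B * V = mat_diag (Suc n) (case_nat e d)"
  proof -
    have "transpose_mat V * B = four_block_mat (mat 1 1 (\<lambda>_. e)) (0\<^sub>m 1 n) (0\<^sub>m n 1) (transpose_mat Q * C)"
      unfolding tV B_block
      using Q C by (subst mult_four_block_mat[of _ 1 1 _ n _ n _ _ 1 _ n]) auto
    then have "transpose_mat V * B * V =
        four_block_mat (mat 1 1 (\<lambda>_. e)) (0\<^sub>m 1 n) (0\<^sub>m n 1) (mat_diag n d)"
      unfolding QCQ[symmetric] V_def
      using Q C by (simp, subst mult_four_block_mat[of _ 1 1 _ n _ n _ _ 1 _ n]) auto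
    also have "\<dots> = mat_diag (Suc n) (case_nat e d)"
      by (intro eq_matI) (auto simp: mat_diag_def split: nat.split)
    finally show ?thesis .
  qed
  have tUV: "transpose_mat (U * V) = transpose_mat V * transpose_mat U"
    using U V by (rule transpose_mult)
  have "transpose_mat (U * V) * (U * V) = transpose_mat V * (transpose_mat U * U) * V"
    unfolding tUV using U V by (simp add: assoc_mult_mat[of _ "Suc n" "Suc n" _ "Suc n" _ "Suc n"])
  then have 1: "transpose_mat (U * V) * (U * V) = 1\<^sub>m (Suc n)"
    using V by (simp add: UU VV)
  have "transpose_mat (U * V) * A * (U * V) = transpose_mat V * B * V"
    unfolding tUV B_def using U V A
    by (simp add: assoc_mult_mat[of _ "Suc n" "Suc n" _ "Suc n" _ "Suc n"])
  then have 2: "transpose_mat (U * V) * A * (U * V) = mat_diag (Suc n) (case_nat e d)"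
    by (simp add: VBV)
  show ?case
    using 1 2 U V by (intro bexI[of _ "U * V"] exI[of _ "case_nat e d"]) auto
qed

section \<open>Counting positive eigenvalues through the quadratic form\<close>

text \<open>Turns algebraic multiplicities into numbers of diagonal positions; the order of a root
  is additive over nonzero factors.\<close>

lemma order_prod_linear_factors:
  fixes d :: "'b \<Rightarrow> 'c :: idom"
  assumes "finite K"
  shows "order r (\<Prod>k\<in>K. [:- d k, 1:]) = card {k \<in> K. d k = r}"
  using assms
proof (induction K rule: finite_induct)
  case (insert x K)
  have "[:- d x, 1:] * (\<Prod>k\<in>K. [:- d k, 1:]) \<noteq> 0"
    using insert.hyps by (simp only: mult_eq_0_iff prod_zero_iff) simp
  then have "order r ([:- d x, 1:] * (\<Prod>k\<in>K. [:- d k, 1:])) =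
      (if d x = r then 1 else 0) + card {k \<in> K. d k = r}"
    using insert.IH by (subst order_mult) (auto simp: order_linear')
  moreover have "{k \<in> insert x K. d k = r} =
      (if d x = r then insert x {k \<in> K. d k = r} else {k \<in> K. d k = r})"
    by auto
  ultimately show ?case
    using insert.hyps by (simp del: mult_pCons_left)
qed simp

lemma num_pos_eigenvalues_diagonalized:
  fixes A P :: "real mat"
  assumes A: "A \<in> carrier_mat n n" and P: "P \<in> carrier_mat n n"
    and PP: "transpose_mat P * P = 1\<^sub>m n" and PAP: "transpose_mat P * A * P = mat_diag n d"
  shows "num_pos_eigenvalues A = card {k. k < n \<and> d k > 0}"
proof -
  have PP': "P * transpose_mat P = 1\<^sub>m n"
    using mat_mult_left_right_inverse[OF _ P PP] P by simp
  have "similar_mat (mat_diag n d) A"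
    using A P PP PP' PAP by (intro similar_matI[of _ _ "transpose_mat P" P n]) auto
  then have "char_poly A = char_poly (mat_diag n d)"
    by (simp add: char_poly_similar)
  also have "\<dots> = (\<Prod>a\<leftarrow>diag_mat (mat_diag n d). [:- a, 1:])"
    by (rule char_poly_upper_triangular[of _ n]) (auto simp: mat_diag_def)
  also have "\<dots> = (\<Prod>k\<leftarrow>[0..<n]. [:- d k, 1:])"
    by (intro arg_cong[where f = prod_list]) (auto simp: diag_mat_def mat_diag_def)
  finally have cp: "char_poly A = (\<Prod>k<n. [:- d k, 1:])"
    by (simp add: prod.distinct_set_conv_list[symmetric] atLeast0LessThan)
  have ev: "eigenvalue A r \<longleftrightarrow> (\<exists>k<n. d k = r)" for r
    by (auto simp: eigenvalue_root_char_poly[OF A] cp poly_prod)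
  let ?S = "{k. k < n \<and> d k > 0}"
  have "num_pos_eigenvalues A = (\<Sum>r\<in>d ` ?S. card {k \<in> {..<n}. d k = r})"
    unfolding num_pos_eigenvalues_def
    by (intro sum.cong) (auto simp: ev cp order_prod_linear_factors)
  \<comment> \<open>The positive positions are grouped by their value \<open>r\<close>, so that the
    sum over distinct eigenvalues counts every position once.\<close>
  also have "\<dots> = (\<Sum>r\<in>d ` ?S. sum (\<lambda>_. 1) {k \<in> ?S. d k = r})"
    by (intro sum.cong) (auto intro: arg_cong[where f = card])
  also have "\<dots> = card ?S"
    by (subst sum.image_gen[of ?S _ d, symmetric]) auto
  finally show ?thesis .
qed

lemma quadratic_form_diagonalized:
  fixes A P :: "real mat"
  assumes A: "A \<in> carrier_mat n n" and P: "P \<in> carrier_mat n n"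
    and PP: "transpose_mat P * P = 1\<^sub>m n" and PAP: "transpose_mat P * A * P = mat_diag n d"
    and y: "y \<in> carrier_vec n"
  shows "(P *\<^sub>v y) \<bullet> (A *\<^sub>v (P *\<^sub>v y)) = (\<Sum>k<n. d k * (y $ k)\<^sup>2)"
proof -
  have Py: "P *\<^sub>v y \<in> carrier_vec n"
    using P y by simp
  have "(P *\<^sub>v y) \<bullet> (A *\<^sub>v (P *\<^sub>v y)) = y \<bullet> (transpose_mat P *\<^sub>v (A *\<^sub>v (P *\<^sub>v y)))"
    using transpose_vec_mult_scalar[of "transpose_mat P" n n "A *\<^sub>v (P *\<^sub>v y)" y] A P Py y by simp
  also have "transpose_mat P *\<^sub>v (A *\<^sub>v (P *\<^sub>v y)) = mat_diag n d *\<^sub>v y"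
    unfolding PAP[symmetric] using A P y
    by (simp add: assoc_mult_mat_vec[of _ n n _ n])
  also have "\<dots> = vec n (\<lambda>k. d k * y $ k)"
    using y by (intro eq_vecI) (auto simp: mat_diag_def scalar_prod_def if_distrib[of "\<lambda>c. c * _"] cong: if_cong)
  finally show ?thesis
    using y by (simp add: scalar_prod_def power2_eq_square atLeast0LessThan algebra_simps)
qed

text \<open>The two-dimensional case of the minimax principle. If only one diagonal entry is
  positive, some nontrivial combination of \<open>x\<close> and \<open>y\<close> kills its
  coordinate; two positive entries span a plane where the form is positive definite. Dependent
  \<open>x\<close> and \<open>y\<close> satisfy the condition through a combination equal to
  zero.\<close>

lemma num_pos_eigenvalues_le_1_iff:
  fixes A :: "real mat"
  assumes A: "A \<in> carrier_mat n n" and sym: "transpose_mat A = A"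
  shows "num_pos_eigenvalues A \<le> 1 \<longleftrightarrow>
    (\<forall>x\<in>carrier_vec n. \<forall>y\<in>carrier_vec n. \<exists>\<alpha> \<beta>. (\<alpha> \<noteq> 0 \<or> \<beta> \<noteq> 0) \<and>
      (\<alpha> \<cdot>\<^sub>v x + \<beta> \<cdot>\<^sub>v y) \<bullet> (A *\<^sub>v (\<alpha> \<cdot>\<^sub>v x + \<beta> \<cdot>\<^sub>v y)) \<le> 0)" (is "_ \<longleftrightarrow> ?R")
proof -
  obtain P d where P: "P \<in> carrier_mat n n" and PP: "transpose_mat P * P = 1\<^sub>m n"
    and PAP: "transpose_mat P * A * P = mat_diag n d"
    using symmetric_real_mat_diagonalization[OF A sym] by blast
  note num = num_pos_eigenvalues_diagonalized[OF A P PP PAP]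
  note form = quadratic_form_diagonalized[OF A P PP PAP]
  have PP': "P * transpose_mat P = 1\<^sub>m n"
    using mat_mult_left_right_inverse[OF _ P PP] P by simp
  have inv: "P *\<^sub>v (transpose_mat P *\<^sub>v x) = x" if "x \<in> carrier_vec n" for x
    using P that PP' by (simp add: assoc_mult_mat_vec[of _ n n _ n, symmetric])
  let ?S = "{k. k < n \<and> d k > 0}"
  show ?thesis
  proof (intro iffI ballI)
    fix x y :: "real vec"
    assume le: "num_pos_eigenvalues A \<le> 1" and x: "x \<in> carrier_vec n" and y: "y \<in> carrier_vec n"
    define x' where "x' = transpose_mat P *\<^sub>v x"
    define y' where "y' = transpose_mat P *\<^sub>v y"
    have x': "x' \<in> carrier_vec n" "P *\<^sub>v x' = x" and y': "y' \<in> carrier_vec n" "P *\<^sub>v y' = y"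
      using P x y inv by (auto simp: x'_def y'_def)
    have comb: "(\<alpha> \<cdot>\<^sub>v x + \<beta> \<cdot>\<^sub>v y) \<bullet> (A *\<^sub>v (\<alpha> \<cdot>\<^sub>v x + \<beta> \<cdot>\<^sub>v y)) =
        (\<Sum>k<n. d k * (\<alpha> * x' $ k + \<beta> * y' $ k)\<^sup>2)" for \<alpha> \<beta>
    proof -
      have "\<alpha> \<cdot>\<^sub>v x + \<beta> \<cdot>\<^sub>v y = P *\<^sub>v (\<alpha> \<cdot>\<^sub>v x' + \<beta> \<cdot>\<^sub>v y')"
        using P x' y' by (simp add: mult_add_distrib_mat_vec[OF P] mult_mat_vec[OF P])
      then show ?thesis
        using form[of "\<alpha> \<cdot>\<^sub>v x' + \<beta> \<cdot>\<^sub>v y'"] x' y' by simp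
    qed
    \<comment> \<open>The inclusion also covers an empty \<open>?S\<close>, where \<open>k\<close>
      is arbitrary.\<close>
    obtain k where k: "?S \<subseteq> {k}"
      using le num by (cases "?S = {}") (auto simp: card_le_Suc0_iff_eq)
    \<comment> \<open>Chosen to make coordinate \<open>k\<close> of the combination vanish. If
      \<open>x'\<close> vanishes there, \<open>x'\<close> itself is taken; otherwise \<beta> is
      nonzero.\<close>
    define \<alpha> \<beta> where "\<alpha> = (if x' $ k = 0 then 1 else y' $ k)" and "\<beta> = (if x' $ k = 0 then 0 else - (x' $ k))"
    have "d j * (\<alpha> * x' $ j + \<beta> * y' $ j)\<^sup>2 \<le> 0" if "j < n" for j
    proof (cases "j = k")
      case True
      then have "\<alpha> * x' $ j + \<beta> * y' $ j = 0"
        by (simp add: \<alpha>_def \<beta>_def)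
      then show ?thesis by simp
    next
      case False
      then have "d j \<le> 0"
        using k that by fastforce
      then show ?thesis
        by (simp add: mult_nonpos_nonneg)
    qed
    then have "(\<alpha> \<cdot>\<^sub>v x + \<beta> \<cdot>\<^sub>v y) \<bullet> (A *\<^sub>v (\<alpha> \<cdot>\<^sub>v x + \<beta> \<cdot>\<^sub>v y)) \<le> 0"
      unfolding comb by (intro sum_nonpos) auto
    moreover have "\<alpha> \<noteq> 0 \<or> \<beta> \<noteq> 0"
      by (auto simp: \<alpha>_def \<beta>_def)
    ultimately show "\<exists>\<alpha> \<beta>. (\<alpha> \<noteq> 0 \<or> \<beta> \<noteq> 0) \<and>
      (\<alpha> \<cdot>\<^sub>v x + \<beta> \<cdot>\<^sub>v y) \<bullet> (A *\<^sub>v (\<alpha> \<cdot>\<^sub>v x + \<beta> \<cdot>\<^sub>v y)) \<le> 0"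
      by blast
  next
    assume R: ?R
    show "num_pos_eigenvalues A \<le> 1"
    proof (rule ccontr)
      assume "\<not> num_pos_eigenvalues A \<le> 1"
      then have "\<not> card ?S \<le> Suc 0"
        using num by simp
      then obtain i j where ij: "i < n" "j < n" "i \<noteq> j" "d i > 0" "d j > 0"
        by (auto simp: card_le_Suc0_iff_eq)
      \<comment> \<open>Columns of \<open>P\<close>, that is, eigenvectors for the two positive
        entries.\<close>
      let ?x = "P *\<^sub>v unit_vec n i" and ?y = "P *\<^sub>v unit_vec n j"
      have "?x \<in> carrier_vec n" "?y \<in> carrier_vec n"
        using P by auto
      then obtain \<alpha> \<beta> where ab: "\<alpha> \<noteq> 0 \<or> \<beta> \<noteq> 0"
        and le: "(\<alpha> \<cdot>\<^sub>v ?x + \<beta> \<cdot>\<^sub>v ?y) \<bullet> (A *\<^sub>v (\<alpha> \<cdot>\<^sub>v ?x + \<beta> \<cdot>\<^sub>v ?y)) \<le> 0"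
        using R by blast
      let ?v = "\<alpha> \<cdot>\<^sub>v unit_vec n i + \<beta> \<cdot>\<^sub>v unit_vec n j"
      have "\<alpha> \<cdot>\<^sub>v ?x + \<beta> \<cdot>\<^sub>v ?y = P *\<^sub>v ?v"
        using P by (simp add: mult_add_distrib_mat_vec[OF P] mult_mat_vec[OF P])
      then have "(\<Sum>k<n. d k * (?v $ k)\<^sup>2) \<le> 0"
        using le form[of ?v] by simp
      also have "(\<Sum>k<n. d k * (?v $ k)\<^sup>2) = (\<Sum>k\<in>{i, j}. d k * (?v $ k)\<^sup>2)"
        using ij by (intro sum.mono_neutral_right) auto
      also have "\<dots> = d i * \<alpha>\<^sup>2 + d j * \<beta>\<^sup>2"
        using ij by simp
      finally show False
        using ij ab
        by (smt (verit, best) mult_pos_pos zero_less_power2 mult_nonneg_nonneg zero_le_power2)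
    qed
  qed
qed

lemma num_pos_eigenvalues_pos:
  fixes A :: "real mat"
  assumes A: "A \<in> carrier_mat n n" and sym: "transpose_mat A = A"
    and x: "x \<in> carrier_vec n" "x \<bullet> (A *\<^sub>v x) > 0"
  shows "num_pos_eigenvalues A > 0"
proof (rule ccontr)
  assume *: "\<not> num_pos_eigenvalues A > 0"
  obtain P d where P: "P \<in> carrier_mat n n" and PP: "transpose_mat P * P = 1\<^sub>m n"
    and PAP: "transpose_mat P * A * P = mat_diag n d"
    using symmetric_real_mat_diagonalization[OF A sym] by blast
  have "P * transpose_mat P = 1\<^sub>m n"
    using mat_mult_left_right_inverse[OF _ P PP] P by simp
  then have "P *\<^sub>v (transpose_mat P *\<^sub>v x) = x"
    using P x by (simp add: assoc_mult_mat_vec[of _ n n _ n, symmetric])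
  then have "x \<bullet> (A *\<^sub>v x) = (\<Sum>k<n. d k * ((transpose_mat P *\<^sub>v x) $ k)\<^sup>2)"
    using quadratic_form_diagonalized[OF A P PP PAP, of "transpose_mat P *\<^sub>v x"] P x by simp
  also have "d k \<le> 0" if "k < n" for k
    using * that num_pos_eigenvalues_diagonalized[OF A P PP PAP] by fastforce
  then have "(\<Sum>k<n. d k * ((transpose_mat P *\<^sub>v x) $ k)\<^sup>2) \<le> 0"
    by (intro sum_nonpos mult_nonpos_nonneg) auto
  finally show False
    using x by simp
qed

section \<open>The quadratic form of a weighted graph\<close>

text \<open>Since \<open>wt\<close> is arbitrary off the edge set, extension by zero allows sums
  over all pairs of vertices.\<close>

definition weight :: "'a wgraph \<Rightarrow> 'a \<Rightarrow> 'a \<Rightarrow> real" where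
  "weight G x y = (if {x, y} \<in> edges G then wt G {x, y} else 0)"

text \<open>The form of the adjacency matrix, evaluated on functions so that no ordering of the
  vertices enters. Each edge is counted in both directions, whence the factors 2 in later
  formulas.\<close>

definition quad_form :: "'a wgraph \<Rightarrow> ('a \<Rightarrow> real) \<Rightarrow> real" where
  "quad_form G f = (\<Sum>x\<in>verts G. \<Sum>y\<in>verts G. weight G x y * f x * f y)"

lemma weight_commute: "weight G x y = weight G y x"
  by (simp add: weight_def insert_commute)

lemma weight_self:
  assumes "weighted_graph G"
  shows "weight G x x = 0"
  using assms by (auto simp: weighted_graph_def weight_def)

lemma weight_nonneg:
  assumes "weighted_graph G"
  shows "weight G x y \<ge> 0"
  using assms by (auto simp: weighted_graph_def weight_def less_imp_le)

lemma weight_eq_0_iff: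
  assumes "weighted_graph G"
  shows "weight G x y = 0 \<longleftrightarrow> {x, y} \<notin> edges G"
  using assms by (force simp: weighted_graph_def weight_def)

lemma adj_matrix_carrier: "adj_matrix G xs \<in> carrier_mat (length xs) (length xs)"
  by (simp add: adj_matrix_def)

lemma transpose_adj_matrix: "transpose_mat (adj_matrix G xs) = adj_matrix G xs"
  by (rule eq_matI) (auto simp: adj_matrix_def insert_commute)

lemma quad_form_adj_matrix:
  assumes "distinct xs" "set xs = verts G"
  shows "vec (length xs) (\<lambda>i. f (xs ! i)) \<bullet> (adj_matrix G xs *\<^sub>v vec (length xs) (\<lambda>i. f (xs ! i))) =
    quad_form G f"
proof -
  have bij: "bij_betw ((!) xs) {..<length xs} (verts G)"
    using bij_betw_nth[OF assms(1) refl] assms(2) by auto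
  have "quad_form G f = (\<Sum>i<length xs. \<Sum>j<length xs.
      weight G (xs ! i) (xs ! j) * f (xs ! i) * f (xs ! j))"
    unfolding quad_form_def
    by (simp add: sum.reindex_bij_betw[OF bij, symmetric])
  then show ?thesis
    by (auto simp: scalar_prod_def adj_matrix_def weight_def atLeast0LessThan sum_distrib_left
        algebra_simps intro!: sum.cong)
qed

lemma vec_as_function_on_verts:
  assumes "distinct xs" "x \<in> carrier_vec (length xs)"
  shows "\<exists>f. x = vec (length xs) (\<lambda>i. f (xs ! i))"
proof -
  have "inj_on ((!) xs) {..<length xs}"
    using assms(1) by (auto simp: inj_on_nth)
  then show ?thesis
    using assms(2) by (intro exI[of _ "\<lambda>t. x $ inv_into {..<length xs} ((!) xs) t"] eq_vecI) auto
qed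

text \<open>Transfers the minimax criterion to functions on vertices: for a repetition-free
  enumeration, every vector is the list of values of such a function.\<close>

lemma i_plus_le_1_iff:
  assumes "finite (verts G)"
  shows "i_plus G \<le> 1 \<longleftrightarrow>
    (\<forall>f g. \<exists>\<alpha> \<beta>. (\<alpha> \<noteq> 0 \<or> \<beta> \<noteq> 0) \<and> quad_form G (\<lambda>x. \<alpha> * f x + \<beta> * g x) \<le> 0)"
proof -
  obtain xs where xs: "distinct xs" "set xs = verts G"
    using finite_distinct_list[OF assms] by blast
  let ?V = "\<lambda>f. vec (length xs) (\<lambda>i. f (xs ! i))"
  have comb: "\<alpha> \<cdot>\<^sub>v ?V f + \<beta> \<cdot>\<^sub>v ?V g = ?V (\<lambda>x. \<alpha> * f x + \<beta> * g x)" for f g \<alpha> \<beta>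
    by (intro eq_vecI) auto
  have carrier_vec_iff: "(\<forall>x\<in>carrier_vec (length xs). P x) \<longleftrightarrow> (\<forall>f. P (?V f))" for P
    using vec_as_function_on_verts[OF xs(1)] by (metis vec_carrier)
  show ?thesis
    unfolding i_plus_eq[OF xs] num_pos_eigenvalues_le_1_iff[OF adj_matrix_carrier transpose_adj_matrix]
      carrier_vec_iff comb quad_form_adj_matrix[OF xs, of "\<lambda>t. \<alpha> * f t + \<beta> * g t" for \<alpha> f \<beta> g] ..
qed

lemma i_plus_pos:
  assumes "finite (verts G)" "quad_form G f > 0"
  shows "i_plus G > 0"
proof -
  obtain xs where xs: "distinct xs" "set xs = verts G"
    using finite_distinct_list[OF assms(1)] by blast
  show ?thesis
    unfolding i_plus_eq[OF xs]
    by (rule num_pos_eigenvalues_pos[OF adj_matrix_carrier transpose_adj_matrix,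
          of "vec (length xs) (\<lambda>i. f (xs ! i))"])
      (use assms(2) quad_form_adj_matrix[OF xs] in auto)
qed

lemma i_plus_iso:
  assumes "finite (verts G)" "wgraph_iso G H"
  shows "i_plus G = i_plus H"
proof -
  obtain f where f: "bij_betw f (verts G) (verts H)"
    "\<forall>x\<in>verts G. \<forall>y\<in>verts G. {x, y} \<in> edges G \<longleftrightarrow> {f x, f y} \<in> edges H"
    "\<forall>x\<in>verts G. \<forall>y\<in>verts G. {x, y} \<in> edges G \<longrightarrow> wt G {x, y} = wt H {f x, f y}"
    using assms(2) by (auto simp: wgraph_iso_def)
  obtain xs where xs: "distinct xs" "set xs = verts G"
    using finite_distinct_list[OF assms(1)] by blast
  have "distinct (map f xs)" "set (map f xs) = verts H"
    using xs f(1) by (auto simp: distinct_map bij_betw_def)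
  moreover have "adj_matrix H (map f xs) = adj_matrix G xs"
    using f(2,3) unfolding xs(2)[symmetric] by (intro eq_matI) (auto simp: adj_matrix_def)
  ultimately show ?thesis
    using i_plus_eq[OF xs] by (simp add: i_plus_eq)
qed

section \<open>Vanishing minors and transitivity of non-adjacency\<close>

lemma quad_form_restrict:
  assumes "finite (verts G)" "S \<subseteq> verts G" "\<And>x. x \<notin> S \<Longrightarrow> f x = 0"
  shows "quad_form G f = (\<Sum>x\<in>S. \<Sum>y\<in>S. weight G x y * f x * f y)"
proof -
  have "quad_form G f = (\<Sum>x\<in>S. \<Sum>y\<in>verts G. weight G x y * f x * f y)"
    unfolding quad_form_def using assms by (intro sum.mono_neutral_right) auto
  also have "\<dots> = (\<Sum>x\<in>S. \<Sum>y\<in>S. weight G x y * f x * f y)"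
    using assms by (intro sum.cong sum.mono_neutral_right) auto
  finally show ?thesis .
qed

text \<open>A nonzero minor makes a 2 by 2 linear system solvable, so the values \<alpha> and
  \<beta> at \<open>u\<close> and \<open>v\<close> can be prescribed and those at \<open>x\<close>
  and \<open>z\<close> adapted to them. The factor \<open>b + 1\<close> lets the resulting squares
  outweigh the mixed term of a possible edge between \<open>u\<close> and \<open>v\<close>, whose
  weight is \<open>b\<close>.\<close>

lemma weight_minor_eq:
  assumes G: "weighted_graph G" and le: "i_plus G \<le> 1"
    and V: "{u, v, x, z} \<subseteq> verts G" and dist: "distinct [u, v, x, z]"
    and nadj: "{x, z} \<notin> edges G"
  shows "weight G u x * weight G v z = weight G v x * weight G u z"
proof (rule ccontr)
  assume neq: "\<not> ?thesis"
  define a1 a2 c1 c2 b where abc: "a1 = weight G u x" "a2 = weight G v x"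
    "c1 = weight G u z" "c2 = weight G v z" "b = weight G u v"
  define D where "D = a1 * c2 - a2 * c1"
  have D: "D \<noteq> 0"
    using neq by (simp add: D_def abc)
  have b: "b \<ge> 0"
    using weight_nonneg[OF G] by (simp add: abc)
  \<comment> \<open>The values at \<open>x\<close> and \<open>z\<close> solve the linear system with matrix \<open>[[a1, c1], [a2, c2]]\<close>
    whose right-hand side is \<open>b + 1\<close> times the values at \<open>u\<close> and \<open>v\<close>.\<close>
  define f where "f = (\<lambda>_. 0)(u := 1, x := (b + 1) * c2 / D, z := - ((b + 1) * a2 / D))"
  define g where "g = (\<lambda>_. 0)(v := 1, x := - ((b + 1) * c1 / D), z := (b + 1) * a1 / D)"
  have "finite (verts G)"
    using G by (simp add: weighted_graph_def)
  then obtain \<alpha> \<beta> where ab: "\<alpha> \<noteq> 0 \<or> \<beta> \<noteq> 0" and q: "quad_form G (\<lambda>t. \<alpha> * f t + \<beta> * g t) \<le> 0"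
    using le i_plus_le_1_iff[of G] by blast
  define X where "X = \<alpha> * f x + \<beta> * g x"
  define Z where "Z = \<alpha> * f z + \<beta> * g z"
  have "D * (a1 * X + c1 * Z) = D * ((b + 1) * \<alpha>)" "D * (a2 * X + c2 * Z) = D * ((b + 1) * \<beta>)"
    using dist D by (simp_all add: X_def Z_def f_def g_def field_simps) (simp_all add: D_def algebra_simps)
  then have XZ: "a1 * X + c1 * Z = (b + 1) * \<alpha>" "a2 * X + c2 * Z = (b + 1) * \<beta>"
    using D by simp_all
  have w0: "weight G x z = 0"
    using nadj by (simp add: weight_def)
  have "quad_form G (\<lambda>t. \<alpha> * f t + \<beta> * g t) = (\<Sum>s\<in>{u, v, x, z}. \<Sum>t\<in>{u, v, x, z}.
      weight G s t * (\<alpha> * f s + \<beta> * g s) * (\<alpha> * f t + \<beta> * g t))"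
    using G V by (intro quad_form_restrict) (auto simp: weighted_graph_def f_def g_def)
  also have "\<dots> = 2 * (b * \<alpha> * \<beta> + \<alpha> * (a1 * X + c1 * Z) + \<beta> * (a2 * X + c2 * Z))"
    by (use dist in \<open>simp add: weight_self[OF G] w0 weight_commute[of G v u] weight_commute[of G x u]
        weight_commute[of G x v] weight_commute[of G z u] weight_commute[of G z v]
        weight_commute[of G z x] abc[symmetric] X_def[symmetric] Z_def[symmetric]\<close>)
      (use dist in \<open>auto simp: f_def g_def algebra_simps\<close>)
  \<comment> \<open>The mixed term is absorbed into a square; the remaining squares are positive
    even if \<open>b\<close> is zero.\<close>
  also have "\<dots> = b * (\<alpha> + \<beta>)\<^sup>2 + b * \<alpha>\<^sup>2 + b * \<beta>\<^sup>2 + 2 * (\<alpha>\<^sup>2 + \<beta>\<^sup>2)"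
    unfolding XZ by (simp add: power2_eq_square algebra_simps)
  also have "\<dots> > 0"
    using b ab by (intro add_nonneg_pos add_nonneg_nonneg) (simp_all add: sum_power2_gt_zero_iff del: distrib_left_numeral)
  finally show False
    using q by simp
qed

text \<open>Transitivity of non-adjacency, in contrapositive form. If \<open>x\<close> were adjacent
  to neither end, take a neighbour \<open>m\<close> of \<open>x\<close>: in the minor of the pairs
  \<open>m, z\<close> and \<open>x, y\<close> one product is positive, while the other contains the
  zero weight of \<open>z, x\<close>.\<close>

lemma i_plus_le_1_adjacent_to_edge:
  assumes G: "weighted_graph G" and le: "i_plus G \<le> 1" and conn: "connected_graph G"
    and yz: "{y, z} \<in> edges G" and x: "x \<in> verts G"
  shows "{x, y} \<in> edges G \<or> {x, z} \<in> edges G"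
proof (rule ccontr)
  assume non: "\<not> ?thesis"
  have V: "y \<in> verts G" "z \<in> verts G" and "y \<noteq> z"
    using G yz by (auto simp: weighted_graph_def)
  have "x \<noteq> y" "x \<noteq> z"
    using non yz by (auto simp: insert_commute)
  \<comment> \<open>The neighbour \<open>m\<close> is the first step of a walk from \<open>x\<close>
    to \<open>y\<close>.\<close>
  have "(x, y) \<in> (adj_rel G)\<^sup>*"
    using conn x V by (auto simp: connected_graph_def)
  then obtain m where m: "{x, m} \<in> edges G"
    using \<open>x \<noteq> y\<close> by (auto simp: adj_rel_def elim: converse_rtranclE)
  have mV: "m \<in> verts G" "m \<noteq> x"
    using G m by (auto simp: weighted_graph_def)
  have "m \<noteq> y" "m \<noteq> z"
    using m non by auto
  have "weight G m x * weight G z y = weight G z x * weight G m y"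
    using weight_minor_eq[OF G le, of m z x y] V mV x non \<open>y \<noteq> z\<close> \<open>x \<noteq> y\<close> \<open>x \<noteq> z\<close> \<open>m \<noteq> y\<close> \<open>m \<noteq> z\<close>
    by auto
  moreover have "weight G z x = 0" "weight G m x \<noteq> 0" "weight G z y \<noteq> 0"
    using non m yz by (auto simp: weight_eq_0_iff[OF G] insert_commute)
  ultimately show False
    by simp
qed

section \<open>Bicyclic graphs with at most one positive eigenvalue\<close>

definition edges_between :: "'a set \<Rightarrow> 'a set \<Rightarrow> 'a set set" where
  "edges_between A B = {{x, y} | x y. x \<in> A \<and> y \<in> B}"

lemma card_edges_between:
  assumes "A \<inter> B = {}"
  shows "card (edges_between A B) = card A * card B"
proof -
  have "edges_between A B = (\<lambda>(x, y). {x, y}) ` (A \<times> B)"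
    by (auto simp: edges_between_def)
  moreover have "inj_on (\<lambda>(x, y). {x, y}) (A \<times> B)"
    using assms by (auto simp: inj_on_def doubleton_eq_iff)
  ultimately show ?thesis
    by (simp add: card_image card_cartesian_product)
qed

lemma edges_between_empty: "edges_between {} B = {}" "edges_between A {} = {}"
  by (simp_all add: edges_between_def)

lemma edges_between_insert: "edges_between (insert x A) B = (\<lambda>y. {x, y}) ` B \<union> edges_between A B"
  by (auto simp: edges_between_def)

text \<open>Here \<open>a\<close> and \<open>b\<close> are the sizes of two parts, \<open>r\<close>
  counts the other vertices and \<open>e\<close> the edges among those. With
  \<open>a = p + 1\<close> and \<open>b = q + 1\<close> the equation becomes
  \<open>p * q + (p + q + 1) * r + e = 2\<close>, which has few solutions.\<close>

lemma edge_count_cases: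
  fixes a b r e :: nat
  assumes eq: "a * b + (a + b) * r + e = a + b + r + 1"
    and pos: "a > 0" "b > 0" and e: "r \<le> 1 \<Longrightarrow> e = 0"
  shows "e = 0 \<and>
    (a = 2 \<and> b = 3 \<and> r = 0 \<or> a = 3 \<and> b = 2 \<and> r = 0 \<or>
     a = 1 \<and> b = 2 \<and> r = 1 \<or> a = 2 \<and> b = 1 \<and> r = 1 \<or> a = 1 \<and> b = 1 \<and> r = 2)"
proof -
  obtain p q where p: "a = Suc p" and q: "b = Suc q"
    using pos by (metis gr0_implies_Suc)
  have eq': "p * q + (p + q + 1) * r + e = 2"
    using eq by (simp add: p q algebra_simps)
  consider "r = 0" | "r = 1" | "r = 2" | "r > 2"
    by linarith
  then show ?thesis
  proof cases
    case 1
    then have pq: "p * q = 2" and "e = 0"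
      using eq' e by auto
    then have "p dvd 2"
      by (metis dvd_triv_left)
    then have "p \<le> 2"
      by (simp add: dvd_imp_le)
    then have "p = 0 \<or> p = 1 \<or> p = 2"
      by auto
    then show ?thesis
      using pq \<open>e = 0\<close> 1 by (auto simp: p q)
  next
    case 2
    then have "p \<le> 1" "q \<le> 1" "e = 0"
      using eq' e by auto
    then have "p = 0 \<or> p = 1" "q = 0 \<or> q = 1"
      by auto
    then show ?thesis
      using eq' 2 \<open>e = 0\<close> by (auto simp: p q)
  next
    case 3
    then show ?thesis
      using eq' by (auto simp: p q)
  next
    case 4
    then have "(p + q + 1) * r > 2"
      by (simp add: add_mult_distrib)
    then show ?thesis
      using eq' by linarith
  qed
qed

text \<open>Split the vertices along an edge \<open>uv\<close> into the part \<open>U\<close> of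
  \<open>u\<close>, the part \<open>W\<close> of \<open>v\<close> and the rest \<open>R\<close>, and
  compare the numbers of edges and vertices. In every surviving case \<open>R\<close> spans no edge,
  so the three sizes determine the graph.\<close>

lemma bicyclic_i_plus_le_1_cases:
  assumes G: "weighted_graph G" and bic: "bicyclic G" and le: "i_plus G \<le> 1"
  obtains (K112) u v x z where "distinct [u, v, x, z]" "verts G = {u, v, x, z}"
      "edges G = {{u, v}, {u, x}, {u, z}, {v, x}, {v, z}}"
  | (K23) u v x y z where "distinct [u, v, x, y, z]" "verts G = {u, v, x, y, z}"
      "edges G = {{u, x}, {u, y}, {u, z}, {v, x}, {v, y}, {v, z}}"
proof -
  have conn: "connected_graph G" and card: "card (edges G) = card (verts G) + 1"
    using bic by (auto simp: bicyclic_def)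
  have finV: "finite (verts G)"
    using G by (simp add: weighted_graph_def)
  have card2: "card e = 2" if "e \<in> edges G" for e
    using G that by (simp add: weighted_graph_def)
  have EV: "x \<in> verts G" "y \<in> verts G" "x \<noteq> y" if "{x, y} \<in> edges G" for x y
    using G that by (auto simp: weighted_graph_def)
  note adj = i_plus_le_1_adjacent_to_edge[OF G le conn]
  obtain e where e: "e \<in> edges G"
    using card by fastforce
  then obtain u v where uv: "{u, v} \<in> edges G"
    using card2[of e] by (auto simp: card_2_iff)
  \<comment> \<open>Two of the parts of the complete multipartite graph \<open>G\<close>, and the union of the other parts.\<close>
  define U where "U = {x \<in> verts G. {x, u} \<notin> edges G}"
  define W where "W = {x \<in> verts G. {x, v} \<notin> edges G}"
  define R where "R = {x \<in> verts G. {x, u} \<in> edges G \<and> {x, v} \<in> edges G}"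
  define ER where "ER = {e \<in> edges G. e \<subseteq> R}"
  have V: "verts G = U \<union> W \<union> R"
    by (auto simp: U_def W_def R_def)
  have disj: "U \<inter> W = {}" "(U \<union> W) \<inter> R = {}"
    using adj[OF uv] by (auto simp: U_def W_def R_def)
  have "u \<in> U" "v \<in> W"
    using EV[OF uv] EV(3)[of u u] EV(3)[of v v] by (auto simp: U_def W_def)
  have fin: "finite U" "finite W" "finite R"
    using finV V by auto
  \<comment> \<open>An edge inside \<open>U\<close> would have an end adjacent to \<open>u\<close>;
    likewise for \<open>W\<close> and \<open>v\<close>.\<close>
  have indep: "{x, y} \<notin> edges G" if "x \<in> U \<and> y \<in> U \<or> x \<in> W \<and> y \<in> W" for x y
    using that adj[of x y u] adj[of x y v] EV(1,2)[OF uv] by (auto simp: U_def W_def insert_commute)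
  \<comment> \<open>By disjointness \<open>x\<close> is adjacent to \<open>v\<close>; the vertex
    \<open>y\<close> is adjacent to one end of that edge, and not to \<open>v\<close>.\<close>
  have UW: "{x, y} \<in> edges G" if "x \<in> U" "y \<in> W" for x y
    using that adj[of x v y] disj(1) by (auto simp: U_def W_def insert_commute)
  have UR: "{x, y} \<in> edges G" if "x \<in> U \<union> W" "y \<in> R" for x y
    using that adj[of y u x] adj[of y v x] by (auto simp: U_def W_def R_def insert_commute)
  have E: "edges G = edges_between U W \<union> edges_between (U \<union> W) R \<union> ER"
  proof (intro equalityI subsetI)
    fix e assume e: "e \<in> edges G"
    then obtain x y where xy: "e = {x, y}"
      using G by (auto simp: weighted_graph_def card_2_iff)
    have "x \<in> U \<union> W \<union> R" "y \<in> U \<union> W \<union> R"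
      using EV(1,2)[of x y] e xy V by auto
    then consider "x \<in> U" "y \<in> W" | "x \<in> W" "y \<in> U" | "x \<in> U \<union> W" "y \<in> R" | "x \<in> R" "y \<in> U \<union> W"
      | "x \<in> R" "y \<in> R"
      using indep[of x y] e xy by blast
    then show "e \<in> edges_between U W \<union> edges_between (U \<union> W) R \<union> ER"
      using e unfolding xy edges_between_def ER_def by cases (simp_all, (metis insert_commute)+)
  qed (use UW UR in \<open>auto simp: edges_between_def ER_def\<close>)
  \<comment> \<open>An infinite set has \<open>card\<close> 0, but the number of edges is a
    successor.\<close>
  have finE: "finite (edges G)"
    using card by (metis card.infinite add_is_0 one_neq_zero)
  have d1: "edges_between U W \<inter> edges_between (U \<union> W) R = {}"
    using disj by (auto simp: edges_between_def doubleton_eq_iff)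
  have d2: "(edges_between U W \<union> edges_between (U \<union> W) R) \<inter> ER = {}"
    using disj by (auto simp: edges_between_def ER_def)
  have cardV: "card (verts G) = card U + card W + card R"
    unfolding V using fin disj by (simp add: card_Un_disjoint)
  have cardE: "card (edges G) = card U * card W + (card U + card W) * card R + card ER"
    using finE d1 d2 fin disj unfolding E
    by (simp add: card_Un_disjoint card_edges_between)
  have ER0: "card ER = 0" if "card R \<le> 1"
  proof -
    have "e \<notin> ER" for e
      using card_mono[OF fin(3), of e] card2[of e] \<open>card R \<le> 1\<close> by (auto simp: ER_def)
    then have "ER = {}"
      by blast
    then show ?thesis by simp
  qed
  have eq: "card U * card W + (card U + card W) * card R + card ER = card U + card W + card R + 1"
    using card unfolding cardE cardV .
  have pos: "card U > 0" "card W > 0"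
    using \<open>u \<in> U\<close> \<open>v \<in> W\<close> fin by (auto simp: card_gt_0_iff)
  have cases: "card ER = 0 \<and>
    (card U = 2 \<and> card W = 3 \<and> card R = 0 \<or> card U = 3 \<and> card W = 2 \<and> card R = 0 \<or>
     card U = 1 \<and> card W = 2 \<and> card R = 1 \<or> card U = 2 \<and> card W = 1 \<and> card R = 1 \<or>
     card U = 1 \<and> card W = 1 \<and> card R = 2)"
    by (rule edge_count_cases[OF eq pos ER0])
  have "ER = {}"
    using cases finE by (auto simp: ER_def)
  then have E': "edges G = edges_between U W \<union> edges_between (U \<union> W) R"
    using E by simp
  \<comment> \<open>The same graph recurs according to the edge \<open>uv\<close> chosen: the
    two-element part of \<open>K112\<close> may be \<open>W\<close>, \<open>U\<close> or
    \<open>R\<close>, and the two parts of \<open>K23\<close> may be swapped.\<close>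
  from conjunct2[OF cases] consider
      "card U = 2" "card W = 3" "card R = 0" | "card U = 3" "card W = 2" "card R = 0"
    | "card U = 1" "card W = 2" "card R = 1" | "card U = 2" "card W = 1" "card R = 1"
    | "card U = 1" "card W = 1" "card R = 2"
    by metis
  then show thesis
  proof cases
    case 1
    then obtain u v x y z where *: "U = {u, v}" "W = {x, y, z}" "u \<noteq> v" "x \<noteq> y" "x \<noteq> z" "y \<noteq> z"
      by (auto simp: card_2_iff card_3_iff)
    have "R = {}"
      using 1 fin by simp
    show thesis
    proof (rule K23[of u v x y z])
      show "distinct [u, v, x, y, z]"
        using * disj by auto
      show "verts G = {u, v, x, y, z}"
        unfolding V * \<open>R = {}\<close> by auto
    qed (unfold E' * \<open>R = {}\<close> Un_insert_left Un_empty_left edges_between_empty edges_between_insert,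
        auto simp: insert_commute)
  next
    case 2
    then obtain u v x y z where *: "W = {u, v}" "U = {x, y, z}" "u \<noteq> v" "x \<noteq> y" "x \<noteq> z" "y \<noteq> z"
      by (auto simp: card_2_iff card_3_iff)
    have "R = {}"
      using 2 fin by simp
    show thesis
    proof (rule K23[of u v x y z])
      show "distinct [u, v, x, y, z]"
        using * disj by auto
      show "verts G = {u, v, x, y, z}"
        unfolding V * \<open>R = {}\<close> by auto
    qed (unfold E' * \<open>R = {}\<close> Un_insert_left Un_empty_left edges_between_empty edges_between_insert,
        auto simp: insert_commute)
  next
    case 3
    then obtain u v x z where *: "U = {u}" "R = {v}" "W = {x, z}" "x \<noteq> z"
      by (auto simp: card_2_iff card_1_singleton_iff)
    show thesis
    proof (rule K112[of u v x z])
      show "distinct [u, v, x, z]"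
        using * disj by auto
      show "verts G = {u, v, x, z}"
        unfolding V * by auto
    qed (unfold E' * Un_insert_left Un_empty_left edges_between_empty edges_between_insert,
        auto simp: insert_commute)
  next
    case 4
    then obtain u v x z where *: "W = {u}" "R = {v}" "U = {x, z}" "x \<noteq> z"
      by (auto simp: card_2_iff card_1_singleton_iff)
    show thesis
    proof (rule K112[of u v x z])
      show "distinct [u, v, x, z]"
        using * disj by auto
      show "verts G = {u, v, x, z}"
        unfolding V * by auto
    qed (unfold E' * Un_insert_left Un_empty_left edges_between_empty edges_between_insert,
        auto simp: insert_commute)
  next
    case 5
    then obtain u v x z where *: "U = {u}" "W = {v}" "R = {x, z}" "x \<noteq> z"
      by (auto simp: card_2_iff card_1_singleton_iff)
    show thesis
    proof (rule K112[of u v x z])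
      show "distinct [u, v, x, z]"
        using * disj by auto
      show "verts G = {u, v, x, z}"
        unfolding V * by auto
    qed (unfold E' * Un_insert_left Un_empty_left edges_between_empty edges_between_insert,
        auto simp: insert_commute)
  qed
qed

section \<open>Theta graphs\<close>

lemma verts_theta_111: "verts (theta 1 1 1 a b c) = {Tu, Tv, Tx 1, Ty 1, Tz 1}"
  by (auto simp: theta_def)

lemma verts_theta_101: "verts (theta 1 0 1 a b c) = {Tu, Tv, Tx 1, Tz 1}"
  by (auto simp: theta_def)

text \<open>The upper bounds stay unevaluated to match the index sets that appear on unfolding
  \<open>theta\<close>.\<close>

lemma atLeastAtMost_one_Suc: "{1..0 + 1} = {1 :: nat}" "{1..1 + 1} = {1, 2 :: nat}"
  by auto

lemma edges_theta_111: "edges (theta 1 1 1 a b c) =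
    {{Tu, Tx 1}, {Tu, Ty 1}, {Tu, Tz 1}, {Tv, Tx 1}, {Tv, Ty 1}, {Tv, Tz 1}}"
  unfolding theta_def wgraph.simps atLeastAtMost_one_Suc
  by (simp add: path_edge_def path_vertex_def insert_commute)

lemma edges_theta_101: "edges (theta 1 0 1 a b c) =
    {{Tu, Tv}, {Tu, Tx 1}, {Tu, Tz 1}, {Tv, Tx 1}, {Tv, Tz 1}}"
  unfolding theta_def wgraph.simps atLeastAtMost_one_Suc
  by (simp add: path_edge_def path_vertex_def insert_commute)

lemma wt_theta_111:
  assumes "theta_params 1 1 1 a b c"
  defines "w \<equiv> wt (theta 1 1 1 a b c)"
  shows "w {Tu, Tx 1} = a 1" "w {Tu, Ty 1} = b 1" "w {Tu, Tz 1} = c 1"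
    "w {Tv, Tx 1} = a 2" "w {Tv, Ty 1} = b 2" "w {Tv, Tz 1} = c 2"
  using theta_wt[OF assms(1), of 1] theta_wt[OF assms(1), of 2]
  by (simp_all add: w_def path_edge_def path_vertex_def insert_commute)

lemma wt_theta_101:
  assumes "theta_params 1 0 1 a b c"
  defines "w \<equiv> wt (theta 1 0 1 a b c)"
  shows "w {Tu, Tv} = b 1" "w {Tu, Tx 1} = a 1" "w {Tu, Tz 1} = c 1"
    "w {Tv, Tx 1} = a 2" "w {Tv, Tz 1} = c 2"
  using theta_wt[OF assms(1), of 1] theta_wt[OF assms(1), of 2]
  by (simp_all add: w_def path_edge_def path_vertex_def insert_commute)

lemma theta_111_iso:
  assumes dist: "distinct [u, v, x, y, z]" and V: "verts G = {u, v, x, y, z}"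
    and E: "edges G = {{u, x}, {u, y}, {u, z}, {v, x}, {v, y}, {v, z}}"
    and params: "theta_params 1 1 1 a b c"
    and w: "wt G {u, x} = a 1" "wt G {u, y} = b 1" "wt G {u, z} = c 1"
      "wt G {v, x} = a 2" "wt G {v, y} = b 2" "wt G {v, z} = c 2"
  shows "wgraph_iso G (theta 1 1 1 a b c)"
proof -
  \<comment> \<open>The default value \<open>Tu\<close> is the image of \<open>u\<close>.\<close>
  define f where "f = (\<lambda>_. Tu)(v := Tv, x := Tx 1, y := Ty 1, z := Tz 1)"
  have f: "f u = Tu" "f v = Tv" "f x = Tx 1" "f y = Ty 1" "f z = Tz 1"
    using dist by (auto simp: f_def)
  show ?thesis
    unfolding wgraph_iso_def V E verts_theta_111 edges_theta_111
    using dist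
    by (intro exI[of _ f] conjI)
      (auto simp: bij_betw_def inj_on_def f w wt_theta_111[OF params, simplified]
        insert_commute doubleton_eq_iff)
qed

lemma theta_101_iso:
  assumes dist: "distinct [u, v, x, z]" and V: "verts G = {u, v, x, z}"
    and E: "edges G = {{u, v}, {u, x}, {u, z}, {v, x}, {v, z}}"
    and params: "theta_params 1 0 1 a b c"
    and w: "wt G {u, v} = b 1" "wt G {u, x} = a 1" "wt G {u, z} = c 1"
      "wt G {v, x} = a 2" "wt G {v, z} = c 2"
  shows "wgraph_iso G (theta 1 0 1 a b c)"
proof -
  define f where "f = (\<lambda>_. Tu)(v := Tv, x := Tx 1, z := Tz 1)"
  have f: "f u = Tu" "f v = Tv" "f x = Tx 1" "f z = Tz 1"
    using dist by (auto simp: f_def)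
  show ?thesis
    unfolding wgraph_iso_def V E verts_theta_101 edges_theta_101
    using dist
    by (intro exI[of _ f] conjI)
      (auto simp: bij_betw_def inj_on_def f w wt_theta_101[OF params, simplified]
        insert_commute doubleton_eq_iff)
qed

lemma quad_form_theta_111:
  assumes "theta_params 1 1 1 a b c"
  shows "quad_form (theta 1 1 1 a b c) f =
    2 * (f Tu * (a 1 * f (Tx 1) + b 1 * f (Ty 1) + c 1 * f (Tz 1)) +
         f Tv * (a 2 * f (Tx 1) + b 2 * f (Ty 1) + c 2 * f (Tz 1)))"
  unfolding quad_form_def weight_def verts_theta_111 edges_theta_111
  by (simp add: doubleton_eq_iff wt_theta_111[OF assms, simplified] insert_commute algebra_simps)

lemma quad_form_theta_101:
  assumes "theta_params 1 0 1 a b c"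
  shows "quad_form (theta 1 0 1 a b c) f =
    2 * (b 1 * f Tu * f Tv + f Tu * (a 1 * f (Tx 1) + c 1 * f (Tz 1)) +
         f Tv * (a 2 * f (Tx 1) + c 2 * f (Tz 1)))"
  unfolding quad_form_def weight_def verts_theta_101 edges_theta_101
  by (simp add: doubleton_eq_iff wt_theta_101[OF assms, simplified] insert_commute algebra_simps)

section \<open>The positive index of the two theta families\<close>

text \<open>The kernel of a linear functional has codimension at most one, so it meets every plane
  nontrivially.\<close>

lemma i_plus_le_1I:
  assumes "finite (verts G)"
    and linear: "\<And>\<alpha> \<beta> f g. L (\<lambda>x. \<alpha> * f x + \<beta> * g x) = \<alpha> * L f + \<beta> * L g"
    and nonpos: "\<And>f. L f = 0 \<Longrightarrow> quad_form G f \<le> 0"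
  shows "i_plus G \<le> 1"
  unfolding i_plus_le_1_iff[OF assms(1)]
proof (intro allI)
  fix f g :: "'a \<Rightarrow> real"
  define \<alpha> \<beta> where "\<alpha> = (if L f = 0 then 1 else L g)" and "\<beta> = (if L f = 0 then 0 else - L f)"
  have "\<alpha> \<noteq> 0 \<or> \<beta> \<noteq> 0" "\<alpha> * L f + \<beta> * L g = 0"
    by (auto simp: \<alpha>_def \<beta>_def)
  then show "\<exists>\<alpha> \<beta>. (\<alpha> \<noteq> 0 \<or> \<beta> \<noteq> 0) \<and> quad_form G (\<lambda>x. \<alpha> * f x + \<beta> * g x) \<le> 0"
    using nonpos[of "\<lambda>x. \<alpha> * f x + \<beta> * g x"] linear by auto
qed

text \<open>The conditions say that the weights at \<open>Tv\<close> are \<open>t\<close> times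
  those at \<open>Tu\<close>, so the form factors as \<open>2 * P f * S f\<close>, which is a
  negative square where \<open>P f = - S f\<close>.\<close>

lemma i_plus_theta_111:
  assumes params: "theta_params 1 1 1 a b c"
    and "c 1 * a 2 = a 1 * c 2" "a 2 * b 1 = a 1 * b 2"
  shows "i_plus (theta 1 1 1 a b c) = 1"
proof -
  let ?G = "theta 1 1 1 a b c"
  have fin: "finite (verts ?G)"
    unfolding verts_theta_111 by simp
  have pos: "a 1 > 0" "a 2 > 0"
    using params by (auto simp: theta_params_def)
  define t where "t = a 2 / a 1"
  have t: "a 2 = t * a 1" "b 2 = t * b 1" "c 2 = t * c 1"
    using assms pos by (auto simp: t_def field_simps)
  define S where "S = (\<lambda>f :: theta_vertex \<Rightarrow> real. a 1 * f (Tx 1) + b 1 * f (Ty 1) + c 1 * f (Tz 1))"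
  define P where "P = (\<lambda>f :: theta_vertex \<Rightarrow> real. f Tu + t * f Tv)"
  have q: "quad_form ?G f = 2 * P f * S f" for f
    unfolding quad_form_theta_111[OF params] by (simp add: t P_def S_def algebra_simps)
  have "i_plus ?G \<le> 1"
  proof (rule i_plus_le_1I[OF fin, of "\<lambda>f. P f + S f"])
    fix f assume "P f + S f = 0"
    then have "P f = - S f"
      by simp
    then have "quad_form ?G f = - (2 * (S f)\<^sup>2)"
      unfolding q by (simp add: power2_eq_square)
    then show "quad_form ?G f \<le> 0"
      by simp
  qed (simp add: P_def S_def algebra_simps)
  \<comment> \<open>The indicator function of the ends of one edge gives twice the weight of that
    edge.\<close>
  moreover have "0 < quad_form ?G (\<lambda>x. if x = Tu \<or> x = Tx 1 then 1 else 0)"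
    unfolding quad_form_theta_111[OF params] using pos by simp
  then have "i_plus ?G > 0"
    by (rule i_plus_pos[OF fin])
  ultimately show ?thesis
    by linarith
qed

text \<open>The term of the edge between \<open>Tu\<close> and \<open>Tv\<close> is put into
  \<open>S\<close>. The product \<open>P f * S f\<close> then contains a surplus
  \<open>b 1 * t * (f Tv)\<^sup>2\<close>, and subtracting it keeps the form nonpositive where
  \<open>P f = - S f\<close>.\<close>

lemma i_plus_theta_101:
  assumes params: "theta_params 1 0 1 a b c" and "a 2 * c 1 = a 1 * c 2"
  shows "i_plus (theta 1 0 1 a b c) = 1"
proof -
  let ?G = "theta 1 0 1 a b c"
  have fin: "finite (verts ?G)"
    unfolding verts_theta_101 by simp
  have pos: "a 1 > 0" "a 2 > 0" "b 1 > 0"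
    using params by (auto simp: theta_params_def)
  define t where "t = a 2 / a 1"
  have t: "a 2 = t * a 1" "c 2 = t * c 1" and "t > 0"
    using assms pos by (auto simp: t_def field_simps)
  define S where "S = (\<lambda>f :: theta_vertex \<Rightarrow> real. a 1 * f (Tx 1) + c 1 * f (Tz 1) + b 1 * f Tv)"
  define P where "P = (\<lambda>f :: theta_vertex \<Rightarrow> real. f Tu + t * f Tv)"
  have q: "quad_form ?G f = 2 * P f * S f - 2 * b 1 * t * (f Tv)\<^sup>2" for f
    unfolding quad_form_theta_101[OF params]
    by (simp add: t P_def S_def power2_eq_square algebra_simps)
  have "i_plus ?G \<le> 1"
  proof (rule i_plus_le_1I[OF fin, of "\<lambda>f. P f + S f"])
    fix f assume "P f + S f = 0"
    then have "P f = - S f"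
      by simp
    then have "quad_form ?G f = - (2 * (S f)\<^sup>2) - 2 * b 1 * t * (f Tv)\<^sup>2"
      unfolding q by (simp add: power2_eq_square)
    moreover have "2 * b 1 * t * (f Tv)\<^sup>2 \<ge> 0"
      using pos \<open>t > 0\<close> by simp
    ultimately show "quad_form ?G f \<le> 0"
      using zero_le_power2[of "S f"] by linarith
  qed (simp add: P_def S_def algebra_simps)
  moreover have "0 < quad_form ?G (\<lambda>x. if x = Tu \<or> x = Tx 1 then 1 else 0)"
    unfolding quad_form_theta_101[OF params] using pos by simp
  then have "i_plus ?G > 0"
    by (rule i_plus_pos[OF fin])
  ultimately show ?thesis
    by linarith
qed

section \<open>Bicyclic graphs with exactly one positive eigenvalue\<close>

theorem theorem4p1:
  fixes G :: "'a wgraph"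
  assumes "weighted_graph G" and "bicyclic G"
  shows "i_plus G = 1 \<longleftrightarrow>
    (\<exists>a b c. theta_params 1 1 1 a b c \<and>
       c 1 * a 2 = a 1 * c 2 \<and> a 2 * b 1 = a 1 * b 2 \<and>
       wgraph_iso G (theta 1 1 1 a b c)) \<or>
    (\<exists>a b c. theta_params 1 0 1 a b c \<and>
       a 2 * c 1 = a 1 * c 2 \<and>
       wgraph_iso G (theta 1 0 1 a b c))" (is "_ \<longleftrightarrow> ?T111 \<or> ?T101")
proof
  assume "i_plus G = 1"
  then have le: "i_plus G \<le> 1"
    by simp
  have wpos: "wt G e > 0" if "e \<in> edges G" for e
    using assms(1) that by (auto simp: weighted_graph_def)
  note minor = weight_minor_eq[OF assms(1) le]
  show "?T111 \<or> ?T101"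
    using assms le
  proof (cases rule: bicyclic_i_plus_le_1_cases)
    case (K112 u v x z)
    define a b c where "a = (\<lambda>i. if i = (1::nat) then wt G {u, x} else wt G {v, x})"
      and "b = (\<lambda>i :: nat. wt G {u, v})"
      and "c = (\<lambda>i. if i = (1::nat) then wt G {u, z} else wt G {v, z})"
    have params: "theta_params 1 0 1 a b c"
      using wpos by (auto simp: theta_params_def a_def b_def c_def K112)
    \<comment> \<open>The minor at the only nonadjacent pair \<open>x, z\<close> is the condition on
      the weights.\<close>
    have "wt G {u, x} * wt G {v, z} = wt G {v, x} * wt G {u, z}"
      using minor[of u v x z] K112 by (auto simp: weight_def doubleton_eq_iff)
    then have "a 2 * c 1 = a 1 * c 2"
      by (simp add: a_def c_def)
    moreover have "wgraph_iso G (theta 1 0 1 a b c)"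
      by (rule theta_101_iso[OF K112 params]) (simp_all add: a_def b_def c_def)
    ultimately show ?thesis
      using params by blast
  next
    case (K23 u v x y z)
    define a b c where "a = (\<lambda>i. if i = (1::nat) then wt G {u, x} else wt G {v, x})"
      and "b = (\<lambda>i. if i = (1::nat) then wt G {u, y} else wt G {v, y})"
      and "c = (\<lambda>i. if i = (1::nat) then wt G {u, z} else wt G {v, z})"
    have params: "theta_params 1 1 1 a b c"
      using wpos by (auto simp: theta_params_def a_def b_def c_def K23)
    \<comment> \<open>The minors at the pairs \<open>x, z\<close> and \<open>x, y\<close> are the
      two conditions on the weights.\<close>
    have "wt G {u, x} * wt G {v, z} = wt G {v, x} * wt G {u, z}"
      using minor[of u v x z] K23 by (auto simp: weight_def doubleton_eq_iff)
    moreover have "wt G {u, x} * wt G {v, y} = wt G {v, x} * wt G {u, y}"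
      using minor[of u v x y] K23 by (auto simp: weight_def doubleton_eq_iff)
    ultimately have "c 1 * a 2 = a 1 * c 2" "a 2 * b 1 = a 1 * b 2"
      by (simp_all add: a_def b_def c_def)
    moreover have "wgraph_iso G (theta 1 1 1 a b c)"
      by (rule theta_111_iso[OF K23 params]) (simp_all add: a_def b_def c_def)
    ultimately show ?thesis
      using params by blast
  qed
next
  have "finite (verts G)"
    using assms(1) by (simp add: weighted_graph_def)
  moreover assume "?T111 \<or> ?T101"
  ultimately show "i_plus G = 1"
    using i_plus_iso i_plus_theta_111 i_plus_theta_101 by metis
qed

end
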